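(* If $G$ is a connected biconvex bipartite graph, then there exists a spanning caterpillar in $G$, i.e., a subgraph $T$ of $G$ with $V(T)=V(G)$ such that $T$ is a caterpillar.
   Context: All graphs are finite, simple and undirected. A graph $G=(V,E)$ is bipartite, written $G=(A,B,E)$, if $V$ is partitioned into two sets $A$ and $B$ such that every edge has one end-point in $A$ and the other in $B$. A bipartite graph $G=(A,B,E)$ is a biconvex bipartite graph if there exist (linear) orderings $<_A$ of $A$ and $<_B$ of $B$ such that the neighbors of every vertex in $A$ are consecutive with respect to $<_B$ and the neighbors of every vertex in $B$ are consecutive with respect to $<_A$ (a set of vertices is consecutive with respect to a linear ordering if, whenever $x$ and $y$ are in the set, every $w$ lying between $x$ and $y$ in the ordering is also in the set). A caterpillar is a tree (connected acyclic graph) that results in a path upon deletion of all its leaves; in other words, a tree containing a path $P$ such that every vertex not in $P$ is adjacent to a vertex in $P$. A path may consist of a single vertex, and the tree on two vertices counts as a caterpillar. *)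

theory Defs
  imports "Graph_Theory.Graph_Theory"
begin

text \<open>
  A finite simple undirected graph is a \<open>pair_graph\<close>: a finite vertex set with a symmetric,
  irreflexive set of arcs, so that an edge \<open>{u, v}\<close> is the pair of arcs \<open>(u, v)\<close>, \<open>(v, u)\<close>.
  In a bipartition either side may be empty, so the one-vertex graph is bipartite.
\<close>

definition neighbors :: "'a pair_pre_digraph \<Rightarrow> 'a \<Rightarrow> 'a set" where
  "neighbors G v = {w. (v, w) \<in> parcs G}"

definition bipartition :: "'a pair_pre_digraph \<Rightarrow> 'a set \<Rightarrow> 'a set \<Rightarrow> bool" where
  "bipartition G A B \<longleftrightarrow>
     pverts G = A \<union> B \<and> A \<inter> B = {} \<and>
     (\<forall>(u, v) \<in> parcs G. (u \<in> A \<and> v \<in> B) \<or> (u \<in> B \<and> v \<in> A))"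

text \<open>Linear orders are reflexive here; for \<open>w\<close> equal to \<open>x\<close> or \<open>y\<close> the condition is trivial.\<close>

definition consecutive :: "'a rel \<Rightarrow> 'a set \<Rightarrow> bool" where
  "consecutive r S \<longleftrightarrow>
     (\<forall>x \<in> S. \<forall>y \<in> S. \<forall>w. (x, w) \<in> r \<and> (w, y) \<in> r \<longrightarrow> w \<in> S)"

definition biconvex_bipartite :: "'a pair_pre_digraph \<Rightarrow> 'a set \<Rightarrow> 'a set \<Rightarrow> bool" where
  "biconvex_bipartite G A B \<longleftrightarrow>
     bipartition G A B \<and>
     (\<exists>rA rB. linear_order_on A rA \<and> linear_order_on B rB \<and>
        (\<forall>a \<in> A. consecutive rB (neighbors G a)) \<and>
        (\<forall>b \<in> B. consecutive rA (neighbors G b)))"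

text \<open>
  The library's \<open>forest\<close> and \<open>tree\<close> are unsuitable for symmetric digraphs, since there
  the closed walk \<open>u, v, u\<close> along a single edge is a \<open>cycle\<close>. In a symmetric digraph without
  multiple arcs, the cycles of length at least 3 are exactly the cycles of the undirected graph.
\<close>

definition undirected_acyclic :: "'a pair_pre_digraph \<Rightarrow> bool" where
  "undirected_acyclic G \<longleftrightarrow> \<not> (\<exists>p. pre_digraph.cycle (with_proj G) p \<and> 3 \<le> length p)"

definition undirected_tree :: "'a pair_pre_digraph \<Rightarrow> bool" where
  "undirected_tree T \<longleftrightarrow>
     pair_graph T \<and> Digraph_Component.connected (with_proj T) \<and> undirected_acyclic T"

text \<open>
  Of the two usual phrasings (deleting all leaves leaves a path; some path dominates the tree)
  this is the second, which needs no exception for the tree on two vertices, where deleting all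
  leaves would give the empty graph. A \<open>vpath\<close> is a nonempty sequence of distinct vertices,
  consecutive ones adjacent, and may be a single vertex.
\<close>

definition caterpillar :: "'a pair_pre_digraph \<Rightarrow> bool" where
  "caterpillar T \<longleftrightarrow>
     undirected_tree T \<and>
     (\<exists>p. vpath p (with_proj T) \<and>
        (\<forall>v \<in> pverts T - set p. \<exists>u \<in> set p. (v, u) \<in> parcs T))"

end

(*
  A spanning caterpillar arises from a dominating path by attaching every other vertex to a
  neighbor on the path. To find the path, let i and j in A be neighbors of the first and the last
  vertex of B, and c and d in B neighbors of the first and the last vertex of A; after possibly
  reversing the order of B, i is not after j. Connectedness then forces the edges ci and jd, so
  any path from i to j can be extended, if necessary, to contain c and d as well. Such a path
  dominates: by convexity c is adjacent to all vertices of A up to i, and d to all from j on, while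
  a path cannot get past a vertex between i and j without meeting one of its neighbors. The
  vertices of B are treated alike, with c and d in the role of i and j.
*)

theory Submission
  imports Defs
begin

section \<open>Closed sets, and convexity expressed by integer ranks\<close>

lemma rtrancl_in_closed:
  assumes "(u, v) \<in> R\<^sup>*" and "u \<in> S" and "\<And>x y. (x, y) \<in> R \<Longrightarrow> x \<in> S \<Longrightarrow> y \<in> S"
  shows "v \<in> S"
  using assms by (induction rule: rtrancl_induct) auto

text \<open>Integer ranks stand in for the linear order: comparisons become arithmetic, and
  reversing the order is negating \<open>f\<close>. The vertex \<open>b\<close> ranges over
  everything; when edges only join \<open>A\<close> to the other part, an edge from \<open>b\<close>
  into \<open>A\<close> already places \<open>b\<close> there.\<close>

definition convex_nbrs :: "'a rel \<Rightarrow> 'a set \<Rightarrow> ('a \<Rightarrow> int) \<Rightarrow> bool" where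
  "convex_nbrs E A f \<longleftrightarrow>
     (\<forall>b x y w. (b, x) \<in> E \<longrightarrow> (b, y) \<in> E \<longrightarrow> x \<in> A \<longrightarrow> y \<in> A \<longrightarrow> w \<in> A \<longrightarrow>
        f x \<le> f w \<longrightarrow> f w \<le> f y \<longrightarrow> (b, w) \<in> E)"

lemma convex_nbrsD:
  assumes "convex_nbrs E A f" "(b, x) \<in> E" "(b, y) \<in> E" "x \<in> A" "y \<in> A" "w \<in> A"
    "f x \<le> f w" "f w \<le> f y"
  shows "(b, w) \<in> E"
  using assms unfolding convex_nbrs_def by blast

lemma convex_nbrs_uminus: "convex_nbrs E A f \<Longrightarrow> convex_nbrs E A (\<lambda>x. - f x)"
  unfolding convex_nbrs_def by (metis neg_le_iff_le)

text \<open>The rank counts predecessors. If \<open>(x, y)\<close> were not in \<open>r\<close>,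
  then \<open>y\<close> would precede \<open>x\<close>, and its predecessors would form a proper
  subset of those of \<open>x\<close>, with \<open>x\<close> itself missing; by finiteness its rank
  would be strictly smaller.\<close>

lemma linear_order_rank:
  assumes "linear_order_on A r" and "finite A"
  obtains f :: "'a \<Rightarrow> int" where "\<And>x y. x \<in> A \<Longrightarrow> y \<in> A \<Longrightarrow> f x \<le> f y \<Longrightarrow> (x, y) \<in> r"
proof
  fix x y
  assume xy: "x \<in> A" "y \<in> A" "int (card {z \<in> A. (z, x) \<in> r}) \<le> int (card {z \<in> A. (z, y) \<in> r})"
  show "(x, y) \<in> r"
  proof (rule ccontr)
    assume n: "(x, y) \<notin> r"
    have refl: "refl_on A r" and tr: "trans r" and tot: "total_on A r"
      using assms(1) by (auto simp: order_on_defs)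
    have "(x, x) \<in> r" using refl xy by (auto simp: refl_on_def)
    then have "(y, x) \<in> r" using tot xy n unfolding total_on_def by metis
    then have "{z \<in> A. (z, y) \<in> r} \<subset> {z \<in> A. (z, x) \<in> r}"
      using tr n xy \<open>(x, x) \<in> r\<close> by (auto dest: transD)
    then have "card {z \<in> A. (z, y) \<in> r} < card {z \<in> A. (z, x) \<in> r}"
      using assms(2) by (intro psubset_card_mono) auto
    then show False using xy by simp
  qed
qed

lemma consecutive_imp_convex_nbrs:
  assumes "bipartition G A B" and "\<forall>b \<in> B. consecutive r (neighbors G b)"
    and "\<And>x y. x \<in> A \<Longrightarrow> y \<in> A \<Longrightarrow> f x \<le> f y \<Longrightarrow> (x, y) \<in> r"
  shows "convex_nbrs (parcs G) A f"
  unfolding convex_nbrs_def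
proof (intro allI impI)
  fix b x y w
  assume h: "(b, x) \<in> parcs G" "(b, y) \<in> parcs G" "x \<in> A" "y \<in> A" "w \<in> A" "f x \<le> f w" "f w \<le> f y"
  then have "b \<in> B" using assms(1) unfolding bipartition_def by fastforce
  then have "consecutive r (neighbors G b)" using assms(2) by blast
  moreover have "(x, w) \<in> r" "(w, y) \<in> r" using h assms(3) by auto
  ultimately show "(b, w) \<in> parcs G"
    using h(1,2) unfolding consecutive_def neighbors_def by blast
qed

section \<open>Domination in connected biconvex graphs\<close>

text \<open>
  Picture \<open>E\<close> as a set of cells, with \<open>A\<close> indexing the rows and \<open>B\<close> the columns. If the cell
  \<open>(c, i)\<close> were missing, the cells strictly above row \<open>i\<close> and right of column \<open>c\<close> would be cut
  off from the rest, although \<open>j\<close> has a cell there.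
\<close>
lemma extreme_neighbors_adjacent:
  fixes f g :: "'a \<Rightarrow> int"
  assumes E: "sym E" "E \<subseteq> A \<times> B \<union> B \<times> A" "A \<inter> B = {}"
    and convex: "convex_nbrs E A f" "convex_nbrs E B g"
    and conn: "(j, i) \<in> E\<^sup>*"
    and a1: "\<And>x. x \<in> A \<Longrightarrow> f a1 \<le> f x" and b1: "\<And>x. x \<in> B \<Longrightarrow> g b1 \<le> g x"
    and bm: "\<And>x. x \<in> B \<Longrightarrow> g x \<le> g bm"
    and nbrs: "i \<in> A" "j \<in> A" "c \<in> B" "(i, b1) \<in> E" "(j, bm) \<in> E" "(c, a1) \<in> E"
    and "f i \<le> f j"
  shows "(c, i) \<in> E"
proof (rule ccontr)
  assume n: "(c, i) \<notin> E"
  have s: "(x, y) \<in> E \<Longrightarrow> (y, x) \<in> E" for x y using E(1) by (auto dest: symD)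
  have AB: "(x, y) \<in> E \<Longrightarrow> x \<in> A \<Longrightarrow> y \<in> B" "(x, y) \<in> E \<Longrightarrow> x \<in> B \<Longrightarrow> y \<in> A" for x y
    using E(2,3) by auto
  have mem: "a1 \<in> A" "b1 \<in> B" "bm \<in> B"
    using AB(1)[OF nbrs(4,1)] AB(1)[OF nbrs(5,2)] AB(2)[OF nbrs(6,3)] by auto
  \<comment> \<open>The neighbor \<open>a1\<close> of \<open>c\<close> comes first in
    \<open>A\<close>, so a neighbor at or past \<open>i\<close> would enclose \<open>i\<close> and
    make it adjacent to \<open>c\<close>.\<close>
  have cf: "f y < f i" if y: "(c, y) \<in> E" for y
  proof (rule ccontr)
    assume "\<not> f y < f i"
    then show False
      using convex_nbrsD[OF convex(1) nbrs(6) y mem(1) AB(2)[OF y nbrs(3)] nbrs(1)]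
        a1[OF nbrs(1)] n by simp
  qed
  have ig: "g x < g c" if x: "(i, x) \<in> E" for x
  proof (rule ccontr)
    assume "\<not> g x < g c"
    then show False
      using convex_nbrsD[OF convex(2) nbrs(4) x mem(2) AB(1)[OF x nbrs(1)] nbrs(3)]
        b1[OF nbrs(3)] n s by auto
  qed
  \<comment> \<open>If \<open>x\<close> also had a neighbor at or before \<open>c\<close>, convexity
    would make \<open>c\<close> adjacent to \<open>x\<close>, against \<open>cf\<close>. The case
    \<open>y = z\<close> turns a weak inequality into a strict one.\<close>
  have row: "g c < g y" if xy: "(x, y) \<in> E" and xz: "(x, z) \<in> E" and x: "x \<in> A" "f i \<le> f x"
    and z: "g c \<le> g z" for x y z
  proof (rule ccontr)
    assume "\<not> g c < g y"
    then have "(x, c) \<in> E"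
      using convex_nbrsD[OF convex(2) xy xz AB(1)[OF xy x(1)] AB(1)[OF xz x(1)] nbrs(3)] z by simp
    then show False using cf[OF s] x(2) by force
  qed
  have col: "f i < f y" if xy: "(x, y) \<in> E" and xz: "(x, z) \<in> E" and x: "x \<in> B" "g c \<le> g x"
    and z: "f i \<le> f z" for x y z
  proof (rule ccontr)
    assume "\<not> f i < f y"
    then have "(x, i) \<in> E"
      using convex_nbrsD[OF convex(1) xy xz AB(2)[OF xy x(1)] AB(2)[OF xz x(1)] nbrs(1)] z by simp
    then show False using ig[OF s] x(2) by force
  qed
  \<comment> \<open>The end-points of all edges that lie in the open quadrant beyond
    \<open>i\<close> and \<open>c\<close>; \<open>row\<close> and \<open>col\<close> say that no
    edge leaves this set.\<close>
  define W where "W = {y \<in> A. f i < f y \<and> (\<exists>x. (y, x) \<in> E \<and> g c < g x)}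
    \<union> {x \<in> B. g c < g x \<and> (\<exists>y. (x, y) \<in> E \<and> f i < f y)}"
  have closed: "y \<in> W" if xy: "(x, y) \<in> E" and "x \<in> W" for x y
  proof -
    consider z where "x \<in> A" "f i < f x" "(x, z) \<in> E" "g c < g z"
      | z where "x \<in> B" "g c < g x" "(x, z) \<in> E" "f i < f z"
      using \<open>x \<in> W\<close> unfolding W_def by blast
    then show ?thesis
    proof cases
      case 1
      then have "g c < g y" using row[OF xy] by simp
      then show ?thesis using 1 AB(1)[OF xy] s[OF xy] unfolding W_def by blast
    next
      case 2
      then have "f i < f y" using col[OF xy] by simp
      then show ?thesis using 2 AB(2)[OF xy] s[OF xy] unfolding W_def by blast
    qed
  qed
  \<comment> \<open>The edge between \<open>j\<close> and \<open>bm\<close> lies weakly in the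
    quadrant; \<open>row\<close> and then \<open>col\<close>, each used with \<open>y = z\<close>,
    make this strict.\<close>
  have "g c < g bm" using row[OF nbrs(5,5,2)] bm[OF nbrs(3)] \<open>f i \<le> f j\<close> by simp
  moreover from this have "f i < f j"
    using col[OF s[OF nbrs(5)] s[OF nbrs(5)] mem(3)] \<open>f i \<le> f j\<close> by simp
  ultimately have "j \<in> W" using nbrs unfolding W_def by blast
  then have "i \<in> W" by (rule rtrancl_in_closed[OF conn _ closed])
  then show False using nbrs E(3) unfolding W_def by auto
qed

text \<open>Let \<open>S\<close> consist of the vertices of \<open>A\<close> before \<open>a\<close>
  and the vertices of \<open>B\<close> with a neighbor before \<open>a\<close>. An edge inside
  \<open>P\<close> that leaves \<open>S\<close> would start at a vertex of \<open>B\<close> with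
  neighbors on both sides of \<open>a\<close>, and by convexity that vertex would be adjacent to
  \<open>a\<close>. So if \<open>a\<close> had no neighbor in \<open>P\<close>, a walk inside
  \<open>P\<close> could not get from \<open>x\<close> to \<open>y\<close>.\<close>

lemma connected_dominates_between:
  fixes f :: "'a \<Rightarrow> int"
  assumes E: "sym E" "E \<subseteq> A \<times> B \<union> B \<times> A" "A \<inter> B = {}"
    and convex: "convex_nbrs E A f"
    and conn: "(x, y) \<in> (E \<inter> P \<times> P)\<^sup>*"
    and xy: "x \<in> A" "y \<in> A" "a \<in> A" "f x < f a" "f a < f y"
  shows "\<exists>u \<in> P. (a, u) \<in> E"
proof (rule ccontr)
  assume n: "\<not> ?thesis"
  have s: "(x, y) \<in> E \<Longrightarrow> (y, x) \<in> E" for x y using E(1) by (auto dest: symD)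
  have AB: "(x, y) \<in> E \<Longrightarrow> x \<in> A \<Longrightarrow> y \<in> B" "(x, y) \<in> E \<Longrightarrow> x \<in> B \<Longrightarrow> y \<in> A" for x y
    using E(2,3) by auto
  define S where "S = {u \<in> A. f u < f a} \<union> {b \<in> B. \<exists>z. (b, z) \<in> E \<and> f z < f a}"
  have closed: "v \<in> S" if uv: "(u, v) \<in> E \<inter> P \<times> P" and "u \<in> S" for u v
  proof -
    consider "u \<in> A" "f u < f a" | z where "u \<in> B" "(u, z) \<in> E" "f z < f a"
      using \<open>u \<in> S\<close> unfolding S_def by blast
    then show ?thesis
    proof cases
      case 1
      then show ?thesis using uv AB(1)[of u v] s[of u v] unfolding S_def by blast
    next
      case 2
      have vA: "v \<in> A" using uv AB(2) 2 by blast
      have "f v < f a"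
      proof (rule ccontr)
        assume "\<not> f v < f a"
        then have "(u, a) \<in> E"
          using convex_nbrsD[OF convex 2(2) _ AB(2)[OF 2(2,1)] vA xy(3)] uv 2(3) by simp
        then show False using n s[of u a] uv by blast
      qed
      then show ?thesis using vA unfolding S_def by blast
    qed
  qed
  have "x \<in> S" using xy unfolding S_def by blast
  then have "y \<in> S" by (rule rtrancl_in_closed[OF conn _ closed])
  then show False using xy E(3) unfolding S_def by auto
qed

text \<open>Domination is asserted for every connected \<open>P\<close> through the four vertices
  because the path is chosen only later; the edges \<open>(c, i)\<close> and \<open>(j, d)\<close>
  allow a path from \<open>i\<close> to \<open>j\<close> to be prolonged to \<open>c\<close> and
  \<open>d\<close>.\<close>

lemma dominating_corners:
  fixes f g :: "'a \<Rightarrow> int"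
  assumes E: "sym E" "E \<subseteq> A \<times> B \<union> B \<times> A" "A \<inter> B = {}"
    and fin: "finite A" "A \<noteq> {}" "finite B" "B \<noteq> {}"
    and convex: "convex_nbrs E A f" "convex_nbrs E B g"
    and conn: "\<And>u v. u \<in> A \<union> B \<Longrightarrow> v \<in> A \<union> B \<Longrightarrow> (u, v) \<in> E\<^sup>*"
  obtains c d i j where "i \<in> A" "j \<in> A" "(c, i) \<in> E" "(j, d) \<in> E"
    "\<And>P v. {c, d, i, j} \<subseteq> P \<Longrightarrow> (\<And>x y. x \<in> P \<Longrightarrow> y \<in> P \<Longrightarrow> (x, y) \<in> (E \<inter> P \<times> P)\<^sup>*) \<Longrightarrow>
       v \<in> A \<union> B - P \<Longrightarrow> \<exists>u \<in> P. (v, u) \<in> E"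
proof -
  note result = that
  have s: "(x, y) \<in> E \<Longrightarrow> (y, x) \<in> E" for x y using E(1) by (auto dest: symD)
  have AB: "(x, y) \<in> E \<Longrightarrow> x \<in> A \<Longrightarrow> y \<in> B" "(x, y) \<in> E \<Longrightarrow> x \<in> B \<Longrightarrow> y \<in> A" for x y
    using E(2,3) by auto
  have extr: "\<exists>a b. a \<in> X \<and> b \<in> X \<and> (\<forall>x \<in> X. h a \<le> h x \<and> h x \<le> h b)"
    if "finite X" "X \<noteq> {}" for h :: "'a \<Rightarrow> int" and X
  proof -
    have ex: "\<exists>a \<in> X. \<forall>x \<in> X. k a \<le> k x" for k :: "'a \<Rightarrow> int"
      using arg_min_least[OF that, of _ k] arg_min_if_finite(1)[OF that, of k] by blast
    show ?thesis using ex[of h] ex[of "\<lambda>x. - h x"] by auto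
  qed
  have nbr: "\<exists>w. (v, w) \<in> E" if "v \<in> A \<union> B" for v
  proof -
    \<comment> \<open>Both parts are nonempty and disjoint, so a second vertex exists, and a walk to
      it leaves \<open>v\<close> along an edge.\<close>
    obtain w where "w \<in> A \<union> B" "w \<noteq> v" using fin E(3) that by blast
    then have "(v, w) \<in> E\<^sup>*" using conn that by blast
    then show ?thesis using \<open>w \<noteq> v\<close> by (cases rule: converse_rtranclE) auto
  qed
  \<comment> \<open>Stated for an arbitrary \<open>g\<close> so that it also applies to the reversed
    order of \<open>B\<close>, which exchanges \<open>b1\<close> with \<open>bm\<close> and thereby
    \<open>i\<close> with \<open>j\<close>; one of the two choices satisfies
    \<open>f i \<le> f j\<close>.\<close>
  have main: thesis
    if g: "convex_nbrs E B g" and b: "b1 \<in> B" "bm \<in> B" "\<forall>x \<in> B. g b1 \<le> g x \<and> g x \<le> g bm"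
      and ij: "(b1, i) \<in> E" "(bm, j) \<in> E" "f i \<le> f j" for g b1 bm i j
  proof -
    obtain a1 an where a: "a1 \<in> A" "an \<in> A" "\<forall>x \<in> A. f a1 \<le> f x \<and> f x \<le> f an"
      using extr[OF fin(1,2), of f] by blast
    obtain c d where cd: "(a1, c) \<in> E" "(an, d) \<in> E" using nbr[of a1] nbr[of an] a by blast
    have mem: "i \<in> A" "j \<in> A" "c \<in> B" "d \<in> B" using AB(1)[OF cd(1) a(1)] AB(1)[OF cd(2) a(2)] AB(2)[OF ij(1) b(1)] AB(2)[OF ij(2) b(2)]
    by blast+
    have ci: "(c, i) \<in> E"
    proof (rule extreme_neighbors_adjacent[OF E convex(1) g])
      show "(j, i) \<in> E\<^sup>*" by (rule conn) (use mem in auto)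
      show "(i, b1) \<in> E" "(j, bm) \<in> E" "(c, a1) \<in> E" using s ij cd by auto
    qed (use a(3) b(3) ij(3) mem in simp_all)
    \<comment> \<open>Reversing both orders exchanges \<open>i\<close>, \<open>b1\<close>,
      \<open>a1\<close>, \<open>c\<close> with \<open>j\<close>, \<open>bm\<close>,
      \<open>an\<close>, \<open>d\<close>.\<close>
    have dj: "(d, j) \<in> E"
    proof (rule extreme_neighbors_adjacent[OF E convex_nbrs_uminus[OF convex(1)] convex_nbrs_uminus[OF g]])
      show "(i, j) \<in> E\<^sup>*" by (rule conn) (use mem in auto)
      show "(j, bm) \<in> E" "(i, b1) \<in> E" "(d, an) \<in> E" using s ij cd by auto
    qed (use a(3) b(3) ij(3) mem in simp_all)
    show thesis
    proof (rule result[OF mem(1,2) ci s[OF dj]])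
      fix P v
      assume P: "{c, d, i, j} \<subseteq> P" "\<And>x y. x \<in> P \<Longrightarrow> y \<in> P \<Longrightarrow> (x, y) \<in> (E \<inter> P \<times> P)\<^sup>*"
        and v: "v \<in> A \<union> B - P"
      show "\<exists>u \<in> P. (v, u) \<in> E"
      proof (cases "v \<in> A")
        case vA: True
        consider "f v \<le> f i" | "f j \<le> f v" | "f i < f v" "f v < f j" by linarith
        then show ?thesis
        proof cases
          case 1
          then have "(c, v) \<in> E"
            using convex_nbrsD[OF convex(1) s[OF cd(1)] ci a(1) mem(1) vA] a(3) vA by simp
          then show ?thesis using P(1) s by blast
        next
          case 2
          then have "(d, v) \<in> E"
            using convex_nbrsD[OF convex(1) dj s[OF cd(2)] mem(2) a(2) vA] a(3) vA by simp
          then show ?thesis using P(1) s by blast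
        next
          case 3
          have "(i, j) \<in> (E \<inter> P \<times> P)\<^sup>*" using P(1) by (intro P(2)) auto
          then show ?thesis
            by (rule connected_dominates_between[OF E convex(1) _ mem(1,2) vA 3])
        qed
      next
        case False
        then have vB: "v \<in> B" using v by blast
        \<comment> \<open>These cases are exhaustive even if \<open>d\<close> comes before
          \<open>c\<close>. In the first two, \<open>i\<close> is adjacent to \<open>b1\<close> and
          \<open>c\<close>, and \<open>j\<close> to \<open>d\<close> and \<open>bm\<close>.\<close>
        consider "g v \<le> g c" | "g d \<le> g v" | "g c < g v" "g v < g d" by linarith
        then show ?thesis
        proof cases
          case 1
          then have "(i, v) \<in> E"
            using convex_nbrsD[OF g s[OF ij(1)] s[OF ci] b(1) mem(3) vB] b(3) vB by simp
          then show ?thesis using P(1) s by blast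
        next
          case 2
          then have "(j, v) \<in> E"
            using convex_nbrsD[OF g s[OF dj] s[OF ij(2)] mem(4) b(2) vB] b(3) vB by simp
          then show ?thesis using P(1) s by blast
        next
          case 3
          have "E \<subseteq> B \<times> A \<union> A \<times> B" "B \<inter> A = {}" using E by auto
          moreover have "(c, d) \<in> (E \<inter> P \<times> P)\<^sup>*" using P(1) by (intro P(2)) auto
          ultimately show ?thesis
            by (rule connected_dominates_between[OF E(1) _ _ g _ mem(3,4) vB 3])
        qed
      qed
    qed
  qed
  obtain b1 bm where b: "b1 \<in> B" "bm \<in> B" "\<forall>x \<in> B. g b1 \<le> g x \<and> g x \<le> g bm"
    using extr[OF fin(3,4), of g] by blast
  obtain i j where ij: "(b1, i) \<in> E" "(bm, j) \<in> E" using nbr[of b1] nbr[of bm] b by blast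
  show thesis
  proof (cases "f i \<le> f j")
    case True
    then show thesis using main[OF convex(2) b ij] by blast
  next
    case False
    then show thesis
      using main[OF convex_nbrs_uminus[OF convex(2)] b(2,1) _ ij(2,1)] b(3) by simp
  qed
qed

section \<open>Trees given by parent functions\<close>

lemma pcas_nth:
  assumes "pcas u p v" and "k < length p"
  shows "fst (p ! k) = (if k = 0 then u else snd (p ! (k - 1)))"
  using assms
proof (induction p arbitrary: u k)
  case (Cons e p)
  then show ?case by (cases k) (auto split: if_splits)
qed simp

lemma pcas_last: "pcas u p v \<Longrightarrow> p \<noteq> [] \<Longrightarrow> snd (last p) = v"
  by (induction p arbitrary: u) auto

lemma pawalk_verts_conv_snd: "pcas u p v \<Longrightarrow> pawalk_verts u p = u # map snd p"
  by (induction p arbitrary: u) auto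

text \<open>Heights drop along parents, so following parents from any vertex ends at
  \<open>r\<close>, which gives connectedness. Acyclicity comes from looking at a highest vertex of
  a supposed cycle.\<close>

lemma undirected_tree_of_parents:
  fixes h :: "'a \<Rightarrow> nat"
  assumes "finite V" "r \<in> V"
    and par: "\<And>v. v \<in> V \<Longrightarrow> v \<noteq> r \<Longrightarrow> par v \<in> V \<and> h (par v) < h v"
  defines "R \<equiv> {(v, par v) | v. v \<in> V - {r}}"
  shows "undirected_tree \<lparr>pverts = V, parcs = R \<union> R\<inverse>\<rparr>"
proof -
  define T where "T = \<lparr>pverts = V, parcs = R \<union> R\<inverse>\<rparr>"
  have verts: "pverts T = V" and arcs: "parcs T = R \<union> R\<inverse>" by (simp_all add: T_def)
  have RV: "R \<union> R\<inverse> \<subseteq> V \<times> V" using par unfolding R_def by auto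
  have pg: "pair_graph T"
  proof
    show "finite (parcs T)" using RV finite_subset assms(1) unfolding arcs by blast
    show "fst e \<noteq> snd e" if "e \<in> parcs T" for e
      using that par unfolding arcs R_def by fastforce
    show "symmetric (with_proj T)" by (auto simp: symmetric_def arcs sym_def)
  qed (use assms RV in \<open>auto simp: verts arcs\<close>)
  interpret T: pair_graph T by fact
  have reach: "v \<rightarrow>\<^sup>*\<^bsub>with_proj T\<^esub> r" if "v \<in> V" for v
    using that
  proof (induction "h v" arbitrary: v rule: less_induct)
    case less
    show ?case
    proof (cases "v = r")
      case True
      then show ?thesis using less T.reachable_refl by (simp add: verts)
    next
      case False
      then have "(v, par v) \<in> parcs T" using less by (auto simp: arcs R_def)
      moreover have "par v \<rightarrow>\<^sup>*\<^bsub>with_proj T\<^esub> r" using less False par by blast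
      ultimately show ?thesis using T.adj_reachable_trans by blast
    qed
  qed
  have conn: "Digraph_Component.connected (with_proj T)"
    unfolding connected_def strongly_connected_def
  proof (intro conjI ballI)
    fix u v assume "u \<in> verts (with_proj (mk_symmetric (with_proj T)))"
      "v \<in> verts (with_proj (mk_symmetric (with_proj T)))"
    then have "u \<rightarrow>\<^sup>*\<^bsub>with_proj T\<^esub> r" "r \<rightarrow>\<^sup>*\<^bsub>with_proj T\<^esub> v"
      using reach T.symmetric_reachable' by (auto simp: verts)
    then show "u \<rightarrow>\<^sup>*\<^bsub>with_proj (mk_symmetric (with_proj T))\<^esub> v"
      using T.reachable_trans T.reachable_mk_symmetricI by blast
  qed (use assms in \<open>auto simp: verts\<close>)
  have "\<not> 3 \<le> length p" if cycle: "pre_digraph.cycle (with_proj T) p" for p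
  proof
    assume n: "3 \<le> length p"
    obtain u where u: "pcas u p u" "distinct (tl (pawalk_verts u p))" "set p \<subseteq> parcs T" "p \<noteq> []"
      using cycle
      by (auto simp: pre_digraph.cycle_def pre_digraph.awalk_def cas_with_proj_eq awalk_verts_with_proj_eq)
    let ?n = "length p"
    \<comment> \<open>Indexing vertices by the arcs ending in them lists each vertex of the cycle
      once, which is what distinctness of the tail of the vertex list provides.\<close>
    define x where "x k = snd (p ! k)" for k
    have inj: "x k = x l \<longleftrightarrow> k = l" if "k < ?n" "l < ?n" for k l
      using u(1,2) that by (auto simp: pawalk_verts_conv_snd x_def distinct_conv_nth)
    \<comment> \<open>Cyclic neighbors of an index: the arc \<open>p ! k\<close> runs from
      \<open>x (prev k)\<close> to \<open>x k\<close>.\<close>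
    define prev where "prev k = (if k = 0 then ?n - 1 else k - 1)" for k
    define nxt where "nxt k = (if Suc k = ?n then 0 else Suc k)" for k
    have fst: "fst (p ! k) = x (prev k)" if "k < ?n" for k
      using pcas_nth[OF u(1) that] pcas_last[OF u(1,4)] u(4)
      by (auto simp: prev_def x_def last_conv_nth)
    \<comment> \<open>At a vertex of maximal height, both neighbors on the cycle would have to be its parent.\<close>
    have "finite {..<?n}" "{..<?n} \<noteq> {}" using u(4) by auto
    then obtain k where k: "k < ?n" "\<And>l. l < ?n \<Longrightarrow> h (x l) \<le> h (x k)"
      using obtains_MAX[of "{..<?n}" "\<lambda>l. h (x l)"]
      by (metis Max_ge finite_imageI imageI lessThan_iff)
    \<comment> \<open>Length at least 3 enters here: in a closed walk of length 2 the indices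
      \<open>prev k\<close> and \<open>nxt k\<close> coincide.\<close>
    have lt: "prev k < ?n" "nxt k < ?n" "prev (nxt k) = k" "prev k \<noteq> nxt k"
      using k(1) n by (auto simp: prev_def nxt_def)
    \<comment> \<open>Otherwise \<open>x k\<close> would be the parent of \<open>y\<close> and hence
      strictly lower.\<close>
    have low: "y = par (x k)" if "(x k, y) \<in> R \<union> R\<inverse>" "h y \<le> h (x k)" for y
      using that par unfolding R_def by force
    have "p ! l \<in> R \<union> R\<inverse>" if "l < ?n" for l using u(3) nth_mem[OF that] unfolding arcs by blast
    from this[OF k(1)] this[OF lt(2)]
    have "(x (prev k), x k) \<in> R \<union> R\<inverse>" "(x k, x (nxt k)) \<in> R \<union> R\<inverse>"
      using fst[OF k(1)] fst[OF lt(2)] lt(3) by (metis prod.collapse x_def)+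
    then have "x (prev k) = par (x k)" "x (nxt k) = par (x k)"
      using low[OF _ k(2)[OF lt(1)]] low[OF _ k(2)[OF lt(2)]] by blast+
    then show False using inj lt by metis
  qed
  then have "undirected_acyclic T" unfolding undirected_acyclic_def by blast
  then show ?thesis using pg conn unfolding undirected_tree_def T_def by blast
qed

section \<open>From a dominating path to a spanning caterpillar\<close>

lemma set_vwalk_arcs_conv_nth: "set (vwalk_arcs p) = {(p ! k, p ! Suc k) | k. Suc k < length p}"
proof (induction p rule: vwalk_arcs.induct)
  case (3 x y xs)
  have "{((x # y # xs) ! k, (x # y # xs) ! Suc k) | k. Suc k < length (x # y # xs)} =
    insert (x, y) {((y # xs) ! k, (y # xs) ! Suc k) | k. Suc k < length (y # xs)}" (is "?L = ?R")
  proof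
    show "?L \<subseteq> ?R"
    proof
      fix e assume "e \<in> ?L"
      then obtain k where "e = ((x # y # xs) ! k, (x # y # xs) ! Suc k)" "Suc k < length (x # y # xs)"
        by blast
      then show "e \<in> ?R" by (cases k) auto
    qed
    show "?R \<subseteq> ?L"
    proof
      fix e assume "e \<in> ?R"
      then consider "e = (x, y)" | k where "e = ((y # xs) ! k, (y # xs) ! Suc k)" "Suc k < length (y # xs)"
        by blast
      then show "e \<in> ?L"
      proof cases
        case 1
        then show ?thesis by (intro CollectI exI[of _ 0]) simp
      next
        case (2 k)
        then show ?thesis by (intro CollectI exI[of _ "Suc k"]) simp
      qed
    qed
  qed
  then show ?case using 3 by simp
qed auto

text \<open>Root the tree at the first vertex of \<open>p\<close>: the parent of a later path vertex
  is its predecessor on the path, and the parent of any other vertex is a chosen neighbor on the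
  path.\<close>

lemma spanning_caterpillar_of_dominating_vpath:
  assumes G: "pair_graph G" and p: "vpath p (with_proj G)"
    and dom: "\<And>v. v \<in> pverts G - set p \<Longrightarrow> \<exists>u \<in> set p. (v, u) \<in> parcs G"
  shows "\<exists>T :: 'a pair_pre_digraph. spanning (with_proj T) (with_proj G) \<and> caterpillar T"
proof -
  interpret G: pair_graph G by fact
  have p': "distinct p" "p \<noteq> []" "set p \<subseteq> pverts G" "set (vwalk_arcs p) \<subseteq> parcs G"
    using p unfolding vpath_def vwalk_def by auto
  obtain w where w: "\<And>v. v \<in> pverts G - set p \<Longrightarrow> w v \<in> set p \<and> (v, w v) \<in> parcs G"
  proof -
    have "\<forall>v \<in> pverts G - set p. \<exists>u. u \<in> set p \<and> (v, u) \<in> parcs G" using dom by blast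
    from bchoice[OF this] show thesis using that by blast
  qed
  \<comment> \<open>This is the position of \<open>v\<close> on the path, and
    \<open>length p\<close> off the path, hence above all path vertices.\<close>
  define h where "h v = length (takeWhile (\<lambda>u. u \<noteq> v) p)" for v
  \<comment> \<open>At the root \<open>p ! 0\<close> the truncated subtraction gives
    \<open>p ! 0\<close> back; \<open>R\<close> leaves this loop out.\<close>
  define par where "par v = (if v \<in> set p then p ! (h v - 1) else w v)" for v
  define V where "V = pverts G"
  define R where "R = {(v, par v) | v. v \<in> V - {p ! 0}}"
  define T where "T = \<lparr>pverts = V, parcs = R \<union> R\<inverse>\<rparr>"
  have h_nth: "h (p ! k) = k" if "k < length p" for k
  proof -
    have "takeWhile (\<lambda>u. u \<noteq> p ! k) p = take k p"
      by (rule takeWhile_eq_take_P_nth) (use that p'(1) in \<open>auto simp: nth_eq_iff_index_eq\<close>)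
    then show ?thesis using that by (simp add: h_def)
  qed
  have h_notin: "h v = length p" if "v \<notin> set p" for v
  proof -
    have "takeWhile (\<lambda>u. u \<noteq> v) p = p" using that by (subst takeWhile_eq_all_conv) auto
    then show ?thesis unfolding h_def by (rule arg_cong)
  qed
  have par_nth: "par (p ! Suc k) = p ! k" if "Suc k < length p" for k
    using that h_nth by (simp add: par_def)
  have par: "par v \<in> V \<and> h (par v) < h v \<and> (v, par v) \<in> parcs G" if v: "v \<in> V" "v \<noteq> p ! 0" for v
  proof (cases "v \<in> set p")
    case True
    then obtain k where k: "v = p ! Suc k" "Suc k < length p"
      using v(2) by (metis in_set_conv_nth not0_implies_Suc)
    then have "(p ! k, p ! Suc k) \<in> parcs G" using p'(4) unfolding set_vwalk_arcs_conv_nth by blast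
    then have "(v, par v) \<in> parcs G" using G.arcs_symmetric k par_nth by simp
    moreover have "par v \<in> V" using k par_nth p'(3) V_def by auto
    moreover have "h (par v) < h v" using k par_nth[of k] h_nth[of k] h_nth[of "Suc k"] by simp
    ultimately show ?thesis by blast
  next
    case False
    then have "w v \<in> set p" "(v, w v) \<in> parcs G" using w v V_def by auto
    moreover from this obtain k where "w v = p ! k" "k < length p" by (metis in_set_conv_nth)
    ultimately show ?thesis using False h_nth[of k] h_notin p'(3) by (auto simp: par_def V_def)
  qed
  have p0: "p ! 0 \<in> V" using p'(2,3) unfolding V_def by auto
  have tree: "undirected_tree T"
    unfolding T_def R_def
  proof (rule undirected_tree_of_parents[where h = h])
    show "finite V" using G.pair_finite_verts by (simp add: V_def)
  qed (use p0 par in auto)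
  have sub: "parcs T \<subseteq> parcs G" using par G.arcs_symmetric by (auto simp: T_def R_def)
  have wf: "pair_graph T" using tree unfolding undirected_tree_def by blast
  interpret T: pair_graph T by fact
  have "spanning (with_proj T) (with_proj G)"
    unfolding spanning_def subgraph_def compatible_def
    using sub G.wf_digraph T.wf_digraph by (auto simp: T_def V_def)
  moreover have "caterpillar T"
    unfolding caterpillar_def
  proof (intro conjI exI ballI)
    \<comment> \<open>These arcs come from the converse of \<open>R\<close>; distinctness of
      \<open>p\<close> ensures that \<open>p ! Suc k\<close> is not the root.\<close>
    have "(p ! k, p ! Suc k) \<in> parcs T" if "Suc k < length p" for k
    proof -
      have "p ! Suc k \<noteq> p ! 0"
        using nth_eq_iff_index_eq[OF p'(1) that, of 0] that by linarith
      moreover have "p ! Suc k \<in> V" using that p'(3) V_def by auto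
      ultimately have "(p ! Suc k, par (p ! Suc k)) \<in> R" unfolding R_def by blast
      then show ?thesis using par_nth[OF that] by (simp add: T_def)
    qed
    then show "vpath p (with_proj T)"
      using p' unfolding vpath_def vwalk_def set_vwalk_arcs_conv_nth by (auto simp: T_def V_def)
    fix v assume v: "v \<in> pverts T - set p"
    then have "v \<in> V - {p ! 0}" "par v = w v" using p'(2) by (auto simp: T_def par_def)
    then have "(v, w v) \<in> parcs T" unfolding T_def R_def by force
    moreover have "w v \<in> set p" using w v by (auto simp: T_def V_def)
    ultimately show "\<exists>u \<in> set p. (v, u) \<in> parcs T" by blast
  qed (rule tree)
  ultimately show ?thesis by blast
qed

section \<open>Walks as connected sets, and the dominating path\<close>

text \<open>An initial segment joins the head to each vertex of the walk, and symmetry allows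
  turning back. This supplies the connectedness that \<open>dominating_corners\<close> asks of
  \<open>P\<close>.\<close>

lemma vwalk_connected:
  assumes "sym (parcs G)" "vwalk p (with_proj G)" "x \<in> set p" "y \<in> set p"
  shows "(x, y) \<in> (parcs G \<inter> set p \<times> set p)\<^sup>*"
proof -
  let ?R = "\<lambda>p. parcs G \<inter> set p \<times> set p"
  have hd: "(hd p, z) \<in> (?R p)\<^sup>*" if "z \<in> set p" for z
    using assms(2) that
  proof (induction p rule: vwalk_induct)
    case (Cons u v es)
    have "?R (v # es) \<subseteq> ?R (u # v # es)" by auto
    then have "(?R (v # es))\<^sup>* \<subseteq> (?R (u # v # es))\<^sup>*" by (rule rtrancl_mono)
    moreover have "(u, v) \<in> ?R (u # v # es)" using Cons(1) by simp
    ultimately show ?case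
      using Cons(2,3) by (cases "z = u") (auto intro: converse_rtrancl_into_rtrancl)
  qed simp
  have "sym ((?R p)\<^sup>*)" using assms(1) by (intro sym_rtrancl) (auto simp: sym_def)
  then show ?thesis using hd[OF assms(3)] hd[OF assms(4)] by (meson rtrancl_trans symD)
qed

theorem theorem1p5:
  fixes G :: "'a pair_pre_digraph" and A B :: "'a set"
  assumes "pair_graph G"
    and "biconvex_bipartite G A B"
    and "Digraph_Component.connected (with_proj G)"
  shows "\<exists>T :: 'a pair_pre_digraph. spanning (with_proj T) (with_proj G) \<and> caterpillar T"
proof -
  interpret G: pair_graph G by fact
  let ?E = "parcs G"
  have bip: "bipartition G A B" using assms(2) unfolding biconvex_bipartite_def by blast
  have V: "pverts G = A \<union> B" and disj: "A \<inter> B = {}" and E: "?E \<subseteq> A \<times> B \<union> B \<times> A"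
    using bip unfolding bipartition_def by auto
  have sym: "sym ?E" using G.arcs_symmetric by (auto simp: sym_def)
  have fin: "finite A" "finite B" using G.pair_finite_verts V by auto
  have reach: "u \<rightarrow>\<^sup>*\<^bsub>with_proj G\<^esub> v" if "u \<in> A \<union> B" "v \<in> A \<union> B" for u v
    using assms(3) that V G.reachable_mk_symmetric_eq[OF G.pair_sym_arcs]
    unfolding connected_def strongly_connected_def by auto
  have conn: "(u, v) \<in> ?E\<^sup>*" if "u \<in> A \<union> B" "v \<in> A \<union> B" for u v
    using reachable_rtranclI[OF reach[OF that]] by simp
  have "\<exists>p. vpath p (with_proj G) \<and> (\<forall>v \<in> pverts G - set p. \<exists>u \<in> set p. (v, u) \<in> ?E)"
  proof (cases "A = {} \<or> B = {}")
    case True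
    \<comment> \<open>Without edges, connectedness leaves only a single vertex.\<close>
    then have no: "?E = {}" using E by auto
    obtain v where v: "v \<in> pverts G"
      using assms(3) unfolding connected_def strongly_connected_def by auto
    have "pverts G \<subseteq> {v}" using conn v V no by auto
    moreover have "vpath [v] (with_proj G)" using v by (auto simp: vpath_def vwalk_def)
    ultimately show ?thesis by (intro exI[of _ "[v]"]) auto
  next
    case False
    obtain rA rB where lin: "linear_order_on A rA" "linear_order_on B rB"
      and cons: "\<forall>a \<in> A. consecutive rB (neighbors G a)" "\<forall>b \<in> B. consecutive rA (neighbors G b)"
      using assms(2) unfolding biconvex_bipartite_def by blast
    obtain f :: "'a \<Rightarrow> int" where f: "\<And>x y. x \<in> A \<Longrightarrow> y \<in> A \<Longrightarrow> f x \<le> f y \<Longrightarrow> (x, y) \<in> rA"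
      using linear_order_rank[OF lin(1) fin(1)] by blast
    obtain g :: "'a \<Rightarrow> int" where g: "\<And>x y. x \<in> B \<Longrightarrow> y \<in> B \<Longrightarrow> g x \<le> g y \<Longrightarrow> (x, y) \<in> rB"
      using linear_order_rank[OF lin(2) fin(2)] by blast
    have convex: "convex_nbrs ?E A f" by (rule consecutive_imp_convex_nbrs[OF bip cons(2) f])
    have "bipartition G B A" using bip unfolding bipartition_def by auto
    then have convex': "convex_nbrs ?E B g" by (rule consecutive_imp_convex_nbrs[OF _ cons(1) g])
    have ne: "A \<noteq> {}" "B \<noteq> {}" using False by auto
    obtain c d i j where ij: "i \<in> A" "j \<in> A" and adj: "(c, i) \<in> ?E" "(j, d) \<in> ?E"
      and dom: "\<And>P v. {c, d, i, j} \<subseteq> P \<Longrightarrow> (\<And>x y. x \<in> P \<Longrightarrow> y \<in> P \<Longrightarrow> (x, y) \<in> (?E \<inter> P \<times> P)\<^sup>*) \<Longrightarrow>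
         v \<in> A \<union> B - P \<Longrightarrow> \<exists>u \<in> P. (v, u) \<in> ?E"
      using dominating_corners[OF sym E disj fin(1) ne(1) fin(2) ne(2) convex convex' conn] by metis
    have "i \<rightarrow>\<^sup>*\<^bsub>with_proj G\<^esub> j" using reach ij by blast
    then obtain q where q: "vpath q (with_proj G)" "hd q = i" "last q = j"
      using G.reachable_vpath_conv by blast
    \<comment> \<open>Adding \<open>c\<close> and \<open>d\<close> only when absent keeps the
      vertices distinct, also if \<open>c = d\<close>. Prepending \<open>c\<close> leaves
      \<open>j\<close> as the last vertex, so \<open>d\<close> can still be attached there.\<close>
    define q' where "q' = (if c \<in> set q then q else c # q)"
    define p where "p = (if d \<in> set q' then q' else q' @ [d])"
    have i: "i \<in> set q" and j: "j \<in> set q" and q_ne: "q \<noteq> []"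
      using q unfolding vpath_def vwalk_def by auto
    have cd: "c \<in> pverts G" "d \<in> pverts G" using adj G.wellformed' by auto
    have q': "vpath q' (with_proj G)" "last q' = j" "{c, i, j} \<subseteq> set q'"
      using q(1) vwalk_consI[of q "with_proj G" c] q(2,3) i j q_ne cd adj(1)
      unfolding q'_def vpath_def by auto
    then have "vwalk (q' @ [d]) (with_proj G)"
      using cd adj(2) unfolding vpath_def vwalk_def by (auto simp: vwalk_arcs_append)
    then have p: "vpath p (with_proj G)" "{c, d, i, j} \<subseteq> set p"
      using q' unfolding p_def vpath_def by auto
    have "vwalk p (with_proj G)" using p(1) by blast
    then show ?thesis
      using dom[OF p(2)] vwalk_connected[OF sym] p(1) V by blast
  qed
  then show ?thesis using spanning_caterpillar_of_dominating_vpath[OF assms(1)] by blast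
qed

end
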